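(* Let $A$ and $\phi$ be real valued $C^2(\mathbb{R})$ functions satisfying $\phi'(0) = -\tfrac34 A(0)^2$. Let $Q = Ae^{i\phi}$ and let $u$ be given by $$u(t,x) = t^{-1/4}Q(t^{-1/2}x),$$ and suppose that $u$ satisfies the Cauchy problem $$i\partial_t u + \partial_x^2 u + i\partial_x(|u|^2u) = 0 \quad (t\ge 1,\ x\in\mathbb{R}), \qquad u(1,x) = Q(x) \quad (x\in\mathbb{R}).$$ Then $Q$, $\phi$ and $A$ satisfy, for all $y\in\mathbb{R}$, $$Q''(y) - \frac i4 Q(y) - \frac i2 yQ'(y) + i\frac{d}{dy}\big(|Q(y)|^2Q(y)\big) = 0,$$ $$\phi'(y) = \frac y4 - \frac34 A(y)^2,$$ $$A''(y) + \frac{y^2}{16}A(y) = \frac y4 A(y)^3 - \frac{3}{16}A(y)^5.$$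
   Context: The Cauchy problem is that of the derivative nonlinear Schrödinger equation, and $u$ is a self-similar solution with profile function $Q$. The amplitude $A$ is real valued and may take negative values.
   Formalization: The phase equation for φ' is asserted only when A is not identically zero; for A = 0, φ = 0 all hypotheses hold (Q = 0, u = 0) but φ' = 0 is not y/4. The other two equations are asserted in all cases. *)

theory Defs
  imports "HOL-Analysis.Analysis"
begin

definition C2_on_reals :: "(real \<Rightarrow> real) \<Rightarrow> bool" where
  "C2_on_reals f \<longleftrightarrow> f C1_differentiable_on UNIV \<and> deriv f C1_differentiable_on UNIV"

(* The derivative of a complex-valued function of a real variable
   (deriv requires the argument and value types to coincide). *)
abbreviation vderiv :: "(real \<Rightarrow> complex) \<Rightarrow> real \<Rightarrow> complex" where
  "vderiv f x \<equiv> vector_derivative f (at x)"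

(* Classical solutions, in the sense that all partial derivatives in the equation exist
   pointwise.  The time derivative is taken relative to the time domain, so it is one-sided at
   t = 1, and only the values u t x with t \<ge> 1 matter.  Differentiability of the
   nonlinearity in x follows from that of u t. *)
definition solves_DNLS_Cauchy :: "(real \<Rightarrow> real \<Rightarrow> complex) \<Rightarrow> (real \<Rightarrow> complex) \<Rightarrow> bool" where
  "solves_DNLS_Cauchy u u1 \<longleftrightarrow>
     (\<forall>t\<ge>1. \<forall>x.
        (\<lambda>s. u s x) differentiable (at t within {1..}) \<and>
        u t differentiable (at x) \<and>
        vderiv (u t) differentiable (at x) \<and>
        \<i> * vector_derivative (\<lambda>s. u s x) (at t within {1..})
          + vderiv (vderiv (u t)) x
          + \<i> * vderiv (\<lambda>z. of_real ((cmod (u t z))\<^sup>2) * u t z) x = 0) \<and>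
     (\<forall>x. u 1 x = u1 x)"

(* A and \<phi> enter the hypotheses only through Q = A e^(i \<phi>) and
   \<phi>'(0) = -3/4 A(0)^2.  When A vanishes identically, Q = 0 says nothing about \<phi>
   (A = \<phi> = 0 satisfies every hypothesis although \<phi>' is not y/4).  The phase equation
   is therefore asserted for A not identically zero; zeros of such an A are allowed. *)

end

theory Submission
  imports Defs
begin

text \<open>
  The profile equation is the evolution equation read off at time \<open>t = 1\<close>: there the self-similar
  ansatz gives \<open>\<partial>\<^sub>t u(1,y) = - Q(y)/4 - y Q'(y)/2\<close> (lemma \<open>self_similar_time_derivative\<close>).

  For the polar variables, every term of the profile equation is a complex amplitude times
  \<open>exp (\<i> \<phi>)\<close>. Dividing by this unit factor and separating real and imaginary parts
  (lemma \<open>polar_profile_system\<close>) gives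
  \<open>A'' - A \<phi>'\<^sup>2 + y A \<phi>' / 2 - A\<^sup>3 \<phi>' = 0\<close> and
  \<open>2 A' \<phi>' + A \<phi>'' - A/4 - y A'/2 + 3 A\<^sup>2 A' = 0\<close>.
  Multiplied by \<open>A\<close>, the second equation says that \<open>A\<^sup>2 (\<phi>' - y/4 + 3 A\<^sup>2/4)\<close> has derivative zero;
  the condition on \<open>\<phi>'(0)\<close> makes this constant vanish (lemma \<open>phase_first_integral\<close>). So the phase
  equation holds wherever \<open>A\<close> is nonzero, and inserted in the first equation it yields the
  equation for \<open>A\<close>, which is trivial at the zeros of \<open>A\<close>.

  At a zero of \<open>A\<close> the second equation reads \<open>2 A' (\<phi>' - y/4) = 0\<close>, which is the phase equation
  as soon as \<open>A'\<close> is nonzero there. A double zero is excluded unless \<open>A\<close> vanishes identically: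
  the first equation has the linear form \<open>A'' = g A\<close> with the continuous coefficient
  \<open>g = \<phi>'\<^sup>2 - y \<phi>'/2 + A\<^sup>2 \<phi>'\<close>, and a double zero propagates by Gronwall's inequality
  (lemma \<open>double_zero_imp_zero\<close>).
\<close>

section \<open>Unique continuation for linear second-order equations\<close>

text \<open>
  The case of Gronwall's inequality with zero initial value: \<open>f e\<^bsup>-Kx\<^esup>\<close> is nonincreasing to the right
  of the zero, and \<open>f e\<^bsup>Kx\<^esup>\<close> is nondecreasing to its left.
\<close>

lemma gronwall_zero:
  fixes f f' :: "real \<Rightarrow> real"
  assumes deriv: "\<And>x. x \<in> {a..b} \<Longrightarrow> (f has_real_derivative f' x) (at x)"
    and nonneg: "\<And>x. x \<in> {a..b} \<Longrightarrow> 0 \<le> f x"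
    and bound: "\<And>x. x \<in> {a..b} \<Longrightarrow> \<bar>f' x\<bar> \<le> K * f x"
    and c: "c \<in> {a..b}" "f c = 0"
    and x: "x \<in> {a..b}"
  shows "f x = 0"
proof (cases "c \<le> x")
  case True
  have "f x * exp (- K * x) \<le> f c * exp (- K * c)"
  proof (rule DERIV_nonpos_imp_nonincreasing[OF True])
    fix z assume "c \<le> z" "z \<le> x"
    then have z: "z \<in> {a..b}" using c x by auto
    have "((\<lambda>z. f z * exp (- K * z)) has_real_derivative (f' z - K * f z) * exp (- K * z)) (at z)"
      by (auto intro!: derivative_eq_intros deriv[OF z] simp: algebra_simps)
    moreover have "(f' z - K * f z) * exp (- K * z) \<le> 0"
      using bound[OF z] by (intro mult_nonpos_nonneg) auto
    ultimately show "\<exists>y. ((\<lambda>z. f z * exp (- K * z)) has_real_derivative y) (at z) \<and> y \<le> 0"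
      by blast
  qed
  then have "f x \<le> 0" using c by (simp add: mult_le_0_iff not_le)
  then show ?thesis using nonneg[OF x] by simp
next
  case False
  then have "x \<le> c" by simp
  have "f x * exp (K * x) \<le> f c * exp (K * c)"
  proof (rule DERIV_nonneg_imp_nondecreasing[OF \<open>x \<le> c\<close>])
    fix z assume "x \<le> z" "z \<le> c"
    then have z: "z \<in> {a..b}" using c x by auto
    have "((\<lambda>z. f z * exp (K * z)) has_real_derivative (f' z + K * f z) * exp (K * z)) (at z)"
      by (auto intro!: derivative_eq_intros deriv[OF z] simp: algebra_simps)
    moreover have "0 \<le> (f' z + K * f z) * exp (K * z)"
      using bound[OF z] by (intro mult_nonneg_nonneg) auto
    ultimately show "\<exists>y. ((\<lambda>z. f z * exp (K * z)) has_real_derivative y) (at z) \<and> 0 \<le> y"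
      by blast
  qed
  then have "f x \<le> 0" using c by (simp add: mult_le_0_iff not_le)
  then show ?thesis using nonneg[OF x] by simp
qed

text \<open>
  The energy \<open>f\<^sup>2 + f'\<^sup>2\<close> has derivative \<open>2 (1 + g) f f'\<close>, which on a compact interval is at most
  a constant multiple of the energy itself.
\<close>

lemma double_zero_imp_zero:
  fixes f f' g :: "real \<Rightarrow> real"
  assumes f: "\<And>x. (f has_real_derivative f' x) (at x)"
    and f': "\<And>x. (f' has_real_derivative g x * f x) (at x)"
    and g: "continuous_on UNIV g"
    and c: "f c = 0" "f' c = 0"
  shows "f x = 0"
proof -
  define a b where "a = min c x" and "b = max c x"
  have "compact ((\<lambda>z. 1 + \<bar>g z\<bar>) ` {a..b})"
    by (intro compact_continuous_image continuous_intros continuous_on_subset[OF g]) auto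
  then obtain K where K: "\<And>z. z \<in> {a..b} \<Longrightarrow> 1 + \<bar>g z\<bar> \<le> K"
    using bounded_imp_bdd_above[OF compact_imp_bounded] by (meson bdd_above.E image_eqI)
  define E where "E z = (f z)\<^sup>2 + (f' z)\<^sup>2" for z
  have "E x = 0"
  proof (rule gronwall_zero[where f = E and a = a and b = b and c = c and K = K
        and f' = "\<lambda>z. 2 * (1 + g z) * (f z * f' z)"])
    fix z assume z: "z \<in> {a..b}"
    show "(E has_real_derivative 2 * (1 + g z) * (f z * f' z)) (at z)"
      unfolding E_def by (auto intro!: derivative_eq_intros f f' simp: algebra_simps)
    show "0 \<le> E z" by (simp add: E_def)
    have "\<bar>2 * (f z * f' z)\<bar> \<le> E z"
      using sum_squares_bound[of "\<bar>f z\<bar>" "\<bar>f' z\<bar>"] by (simp add: E_def abs_mult)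
    moreover have "\<bar>1 + g z\<bar> \<le> K" using K[OF z] by linarith
    ultimately have "\<bar>1 + g z\<bar> * \<bar>2 * (f z * f' z)\<bar> \<le> K * E z"
      by (intro mult_mono) auto
    then show "\<bar>2 * (1 + g z) * (f z * f' z)\<bar> \<le> K * E z"
      by (simp only: abs_mult[symmetric] mult_ac)
  qed (auto simp: a_def b_def E_def c)
  then show ?thesis by (simp add: E_def sum_power2_eq_zero_iff)
qed

section \<open>Derivatives of polar forms and of self-similar functions\<close>

lemma C1_differentiable_onD:
  fixes f :: "real \<Rightarrow> real"
  assumes "f C1_differentiable_on UNIV"
  shows "(f has_real_derivative deriv f x) (at x)" "continuous_on UNIV (deriv f)"
proof -
  obtain D where D: "\<And>x. (f has_vector_derivative D x) (at x)" "continuous_on UNIV D"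
    using assms by (auto simp: C1_differentiable_on_def)
  then have f: "(f has_real_derivative D x) (at x)" for x
    by (simp add: has_real_derivative_iff_has_vector_derivative)
  then have "deriv f = D" by (auto simp: DERIV_imp_deriv)
  then show "(f has_real_derivative deriv f x) (at x)" "continuous_on UNIV (deriv f)"
    using f D(2) by auto
qed

text \<open>
  The amplitude is complex so that the rule can be iterated: one derivative turns the amplitude
  \<open>B\<close> into \<open>B' + \<i> B \<phi>'\<close>.
\<close>

lemma has_vector_derivative_polar:
  fixes B :: "real \<Rightarrow> complex" and \<phi> :: "real \<Rightarrow> real"
  assumes B: "(B has_vector_derivative B') (at x)"
    and \<phi>: "(\<phi> has_real_derivative \<phi>') (at x)"
  shows "((\<lambda>y. B y * exp (\<i> * of_real (\<phi> y))) has_vector_derivative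
           (B' + \<i> * B x * of_real \<phi>') * exp (\<i> * of_real (\<phi> x))) (at x)"
proof -
  have "((\<lambda>y. exp (\<i> * of_real (\<phi> y))) has_vector_derivative
      of_real \<phi>' * (\<i> * exp (\<i> * of_real (\<phi> x)))) (at x)"
  proof -
    have "((\<lambda>z. exp (\<i> * z)) has_field_derivative \<i> * exp (\<i> * of_real (\<phi> x)))
        (at (of_real (\<phi> x) :: complex))"
      by (auto intro!: derivative_eq_intros)
    moreover have "((\<lambda>y. of_real (\<phi> y) :: complex) has_vector_derivative of_real \<phi>') (at x)"
      using \<phi> by (intro has_vector_derivative_of_real)
        (simp add: has_real_derivative_iff_has_vector_derivative)
    ultimately show ?thesis
      using field_vector_diff_chain_at unfolding o_def by blast
  qed
  from has_vector_derivative_mult[OF B this] show ?thesis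
    by (simp add: algebra_simps)
qed

lemma self_similar_time_derivative:
  fixes Q :: "real \<Rightarrow> complex" and p q :: real
  assumes Q: "(Q has_vector_derivative Q') (at y)"
    and u: "\<forall>t\<ge>1. u t = of_real (t powr p) * Q (t powr q * y)"
  shows "vector_derivative u (at 1 within {1..}) = of_real p * Q y + of_real (q * y) * Q'"
proof -
  have powr: "((\<lambda>t. t powr r) has_real_derivative r) (at 1)" for r :: real
    by (auto intro!: derivative_eq_intros)
  have "((\<lambda>t. t powr q * y) has_vector_derivative q * y) (at 1)"
    unfolding has_real_derivative_iff_has_vector_derivative[symmetric]
    by (auto intro!: derivative_eq_intros)
  then have "((\<lambda>t. Q (t powr q * y)) has_vector_derivative (q * y) *\<^sub>R Q') (at 1)"
    using vector_diff_chain_at[of "\<lambda>t. t powr q * y" _ 1 Q Q'] Q by (simp add: o_def)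
  moreover have "((\<lambda>t. of_real (t powr p) :: complex) has_vector_derivative of_real p) (at 1)"
    using powr[of p] by (intro has_vector_derivative_of_real)
      (simp add: has_real_derivative_iff_has_vector_derivative)
  ultimately have "((\<lambda>t. of_real (t powr p) * Q (t powr q * y)) has_vector_derivative
      of_real p * Q y + of_real (q * y) * Q') (at 1)"
    using has_vector_derivative_mult[of "\<lambda>t. of_real (t powr p)" "of_real p" 1]
    by (fastforce simp: scaleR_conv_of_real add.commute)
  then have "((\<lambda>t. of_real (t powr p) * Q (t powr q * y)) has_vector_derivative
      of_real p * Q y + of_real (q * y) * Q') (at 1 within {1..})"
    by (rule has_vector_derivative_at_within)
  then have "(u has_vector_derivative of_real p * Q y + of_real (q * y) * Q') (at 1 within {1..})"
    by (rule has_vector_derivative_transform[rotated 2]) (use u in auto)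
  moreover have "at (1::real) within {1..} \<noteq> bot"
    by (simp add: at_within_Ici_at_right trivial_limit_at_right_real)
  ultimately show ?thesis by (intro vector_derivative_within)
qed

section \<open>The profile in polar variables\<close>

definition profile_equation :: "(real \<Rightarrow> complex) \<Rightarrow> real \<Rightarrow> bool" where
  "profile_equation Q y \<longleftrightarrow>
     vderiv (vderiv Q) y - (\<i>/4) * Q y - (\<i>/2) * of_real y * vderiv Q y
       + \<i> * vderiv (\<lambda>z. of_real ((cmod (Q z))\<^sup>2) * Q z) y = 0"

text \<open>
  The real part is arranged as a linear equation for \<open>A\<close> with a coefficient that stays continuous
  at the zeros of \<open>A\<close>; this is the form in which double zeros can be excluded.
\<close>

lemma polar_profile_system:
  fixes A A' A'' \<phi> \<phi>' \<phi>'' :: "real \<Rightarrow> real"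
  assumes A: "\<And>x. (A has_real_derivative A' x) (at x)" "\<And>x. (A' has_real_derivative A'' x) (at x)"
    and \<phi>: "\<And>x. (\<phi> has_real_derivative \<phi>' x) (at x)" "\<And>x. (\<phi>' has_real_derivative \<phi>'' x) (at x)"
    and eq: "profile_equation (\<lambda>y. of_real (A y) * exp (\<i> * of_real (\<phi> y))) y"
  shows "A'' y = ((\<phi>' y)\<^sup>2 - y / 2 * \<phi>' y + (A y)\<^sup>2 * \<phi>' y) * A y"
    and "2 * A' y * \<phi>' y + A y * \<phi>'' y - A y / 4 - y / 2 * A' y + 3 * (A y)\<^sup>2 * A' y = 0"
proof -
  define Q where "Q = (\<lambda>y. of_real (A y) * exp (\<i> * of_real (\<phi> y)))"
  have cA: "((\<lambda>x. of_real (A x) :: complex) has_vector_derivative of_real (A' x)) (at x)" for x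
    using A(1) by (intro has_vector_derivative_of_real)
      (simp add: has_real_derivative_iff_has_vector_derivative)
  have "(Q has_vector_derivative (of_real (A' x) + \<i> * of_real (A x) * of_real (\<phi>' x))
      * exp (\<i> * of_real (\<phi> x))) (at x)" for x
    unfolding Q_def by (rule has_vector_derivative_polar[OF cA \<phi>(1)])
  then have Q': "vderiv Q x = (of_real (A' x) + \<i> * of_real (A x) * of_real (\<phi>' x))
      * exp (\<i> * of_real (\<phi> x))" for x
    by (rule vector_derivative_at)
  have "((\<lambda>x. of_real (A' x) + \<i> * of_real (A x * \<phi>' x) :: complex) has_vector_derivative
      of_real (A'' y) + \<i> * of_real (A' y * \<phi>' y + A y * \<phi>'' y)) (at y)"
  proof -
    have "((\<lambda>x. A x * \<phi>' x) has_real_derivative A' y * \<phi>' y + A y * \<phi>'' y) (at y)"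
      by (auto intro!: derivative_eq_intros A \<phi>)
    then show ?thesis
      using A(2) by (intro has_vector_derivative_add has_vector_derivative_mult_right
        has_vector_derivative_of_real) (simp_all add: has_real_derivative_iff_has_vector_derivative)
  qed
  from has_vector_derivative_polar[OF this \<phi>(1)]
  have Q'': "vderiv (vderiv Q) y = (of_real (A'' y) + \<i> * of_real (A' y * \<phi>' y + A y * \<phi>'' y)
      + \<i> * (of_real (A' y) + \<i> * of_real (A y * \<phi>' y)) * of_real (\<phi>' y)) * exp (\<i> * of_real (\<phi> y))"
    unfolding Q' by (intro vector_derivative_at) (simp add: mult.assoc)
  have "((\<lambda>x. of_real ((A x)^3) :: complex) has_vector_derivative of_real (3 * (A y)\<^sup>2 * A' y)) (at y)"
    by (intro has_vector_derivative_of_real)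
      (auto intro!: derivative_eq_intros A simp: has_real_derivative_iff_has_vector_derivative[symmetric])
  from has_vector_derivative_polar[OF this \<phi>(1)]
  have N: "vderiv (\<lambda>z. of_real ((cmod (Q z))\<^sup>2) * Q z) y
      = (of_real (3 * (A y)\<^sup>2 * A' y) + \<i> * of_real ((A y)^3) * of_real (\<phi>' y))
        * exp (\<i> * of_real (\<phi> y))"
    by (intro vector_derivative_at)
      (simp add: Q_def norm_mult power2_eq_square power3_eq_cube mult.assoc)
  have "(of_real (A'' y) + \<i> * of_real (A' y * \<phi>' y + A y * \<phi>'' y)
      + \<i> * (of_real (A' y) + \<i> * of_real (A y * \<phi>' y)) * of_real (\<phi>' y)
      - \<i> / 4 * of_real (A y)
      - \<i> / 2 * of_real y * (of_real (A' y) + \<i> * of_real (A y) * of_real (\<phi>' y))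
      + \<i> * (of_real (3 * (A y)\<^sup>2 * A' y) + \<i> * of_real ((A y)^3) * of_real (\<phi>' y)))
      * exp (\<i> * of_real (\<phi> y)) = 0" (is "?W * _ = 0")
    using eq[folded Q_def, unfolded profile_equation_def Q'' N, unfolded Q']
    by (simp add: Q_def algebra_simps)
  then have W: "?W = 0" by simp
  from arg_cong[OF W, of Re]
  show "A'' y = ((\<phi>' y)\<^sup>2 - y / 2 * \<phi>' y + (A y)\<^sup>2 * \<phi>' y) * A y"
    by (simp add: power2_eq_square power3_eq_cube algebra_simps)
  from arg_cong[OF W, of Im]
  show "2 * A' y * \<phi>' y + A y * \<phi>'' y - A y / 4 - y / 2 * A' y + 3 * (A y)\<^sup>2 * A' y = 0"
    by (simp add: power2_eq_square power3_eq_cube algebra_simps)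
qed

text \<open>
  Times \<open>A\<close>, the hypothesis \<open>imag\<close> is an exact derivative. The quantity so conserved is zero
  because its second factor vanishes at the origin by the condition on \<open>\<phi>'(0)\<close>.
\<close>

lemma phase_first_integral:
  fixes A A' \<phi>' \<phi>'' :: "real \<Rightarrow> real"
  assumes A: "\<And>x. (A has_real_derivative A' x) (at x)"
    and \<phi>': "\<And>x. (\<phi>' has_real_derivative \<phi>'' x) (at x)"
    and imag: "\<And>x. 2 * A' x * \<phi>' x + A x * \<phi>'' x - A x / 4 - x / 2 * A' x + 3 * (A x)\<^sup>2 * A' x = 0"
    and init: "\<phi>' 0 = - (3/4) * (A 0)\<^sup>2"
  shows "(A y)\<^sup>2 * (\<phi>' y - y / 4 + 3 / 4 * (A y)\<^sup>2) = 0"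
proof -
  define F where "F x = (A x)\<^sup>2 * (\<phi>' x - x / 4 + 3 / 4 * (A x)\<^sup>2)" for x
  have "(F has_real_derivative 0) (at x)" for x
  proof -
    have "(F has_real_derivative A x *
        (2 * A' x * \<phi>' x + A x * \<phi>'' x - A x / 4 - x / 2 * A' x + 3 * (A x)\<^sup>2 * A' x)) (at x)"
      unfolding F_def
      by (auto intro!: derivative_eq_intros A \<phi>' simp: power2_eq_square algebra_simps)
    then show ?thesis by (simp only: imag mult_zero_right)
  qed
  then have "F y = F 0" by (intro DERIV_isconst_all) auto
  then show ?thesis by (simp add: F_def init)
qed

theorem proposition1p3:
  fixes A \<phi> :: "real \<Rightarrow> real"
    and Q :: "real \<Rightarrow> complex"
    and u :: "real \<Rightarrow> real \<Rightarrow> complex"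
  assumes A_C2: "C2_on_reals A"
    and phi_C2: "C2_on_reals \<phi>"
    and phi_0: "deriv \<phi> 0 = - (3/4) * (A 0)\<^sup>2"
    and Q_eq: "Q = (\<lambda>y. of_real (A y) * exp (\<i> * of_real (\<phi> y)))"
    and u_eq: "\<forall>t\<ge>1. \<forall>x. u t x = of_real (t powr (-1/4)) * Q (t powr (-1/2) * x)"
    and u_sol: "solves_DNLS_Cauchy u Q"
  shows "(\<forall>y. vderiv (vderiv Q) y - (\<i>/4) * Q y - (\<i>/2) * of_real y * vderiv Q y
              + \<i> * vderiv (\<lambda>z. of_real ((cmod (Q z))\<^sup>2) * Q z) y = 0)
       \<and> ((\<exists>y. A y \<noteq> 0) \<longrightarrow> (\<forall>y. deriv \<phi> y = y/4 - (3/4) * (A y)\<^sup>2))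
       \<and> (\<forall>y. deriv (deriv A) y + y\<^sup>2/16 * A y = y/4 * (A y)^3 - (3/16) * (A y)^5)"
proof -
  note A = C1_differentiable_onD[OF A_C2[unfolded C2_on_reals_def, THEN conjunct1]]
    and A' = C1_differentiable_onD[OF A_C2[unfolded C2_on_reals_def, THEN conjunct2]]
    and \<phi> = C1_differentiable_onD[OF phi_C2[unfolded C2_on_reals_def, THEN conjunct1]]
    and \<phi>' = C1_differentiable_onD[OF phi_C2[unfolded C2_on_reals_def, THEN conjunct2]]
  have u1: "u 1 = Q"
    using u_sol by (auto simp: solves_DNLS_Cauchy_def)
  have profile: "profile_equation Q y" for y
  proof -
    have sol: "Q differentiable (at y)"
      "\<i> * vector_derivative (\<lambda>s. u s y) (at 1 within {1..}) + vderiv (vderiv Q) y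
        + \<i> * vderiv (\<lambda>z. of_real ((cmod (Q z))\<^sup>2) * Q z) y = 0"
      using u_sol[unfolded solves_DNLS_Cauchy_def, THEN conjunct1, rule_format, of 1 y]
      unfolding u1 by auto
    have "vector_derivative (\<lambda>s. u s y) (at 1 within {1..})
        = of_real (-1/4) * Q y + of_real (-1/2 * y) * vderiv Q y"
      using sol(1) u_eq by (intro self_similar_time_derivative)
        (auto simp: vector_derivative_works)
    with sol(2) show ?thesis
      unfolding profile_equation_def by (simp add: algebra_simps)
  qed
  note system = polar_profile_system[OF A(1) A'(1) \<phi>(1) \<phi>'(1) profile[unfolded Q_eq]]
  have integral: "A y = 0 \<or> deriv \<phi> y = y/4 - (3/4) * (A y)\<^sup>2" for y
    using phase_first_integral[OF A(1) \<phi>'(1) system(2) phi_0, of y]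
    unfolding mult_eq_0_iff by auto
  have "deriv \<phi> y = y/4 - (3/4) * (A y)\<^sup>2" if "\<exists>y. A y \<noteq> 0" for y
  proof (cases "A y = 0")
    case True
    define g where "g x = (deriv \<phi> x)\<^sup>2 - x / 2 * deriv \<phi> x + (A x)\<^sup>2 * deriv \<phi> x" for x
    have "continuous_on UNIV A"
      using A(1) by (meson DERIV_continuous_on has_field_derivative_at_within)
    then have "continuous_on UNIV g"
      unfolding g_def by (intro continuous_intros \<phi>(2)) auto
    moreover have "(deriv A has_real_derivative g x * A x) (at x)" for x
      using A'(1)[of x] by (simp add: system(1) g_def)
    ultimately have "deriv A y \<noteq> 0"
      using that True double_zero_imp_zero[OF A(1)] by metis
    with system(2)[of y] True show ?thesis by (simp add: field_simps)
  next
    case False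
    then show ?thesis using integral by blast
  qed
  moreover have "deriv (deriv A) y + y\<^sup>2/16 * A y = y/4 * (A y)^3 - (3/16) * (A y)^5" for y
  proof (cases "A y = 0")
    case True
    then show ?thesis by (simp add: system(1))
  next
    case False
    then have phase: "deriv \<phi> y = y/4 - (3/4) * (A y)\<^sup>2" using integral by blast
    show ?thesis
      unfolding system(1) phase
      by (simp add: power2_eq_square eval_nat_numeral algebra_simps)
  qed
  ultimately show ?thesis using profile unfolding profile_equation_def by blast
qed

end
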